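(* Let $d\ge 1$ and let $P\subset\mathbb{R}^d$ be a full-dimensional perfectly centered polytope with dual $P^*$. A subset $H$ of the Minkowski sum $P+P^*$ is a nontrivial face of $P+P^*$ if and only if $H=G+F^D$ for some nontrivial faces $G,F$ of $P$ with $G\subseteq F$.
   Context: Polytopes are convex hulls of finite sets; $P+Q=\{p+q: p\in P,\ q\in Q\}$. The faces of a polytope $P$ include $\emptyset$ and $P$; these two are called trivial, all others nontrivial. For $c\in\mathbb{R}^d$ let $S(P;c)=\{x\in P:\langle x,c\rangle=\max_{y\in P}\langle y,c\rangle\}$. For a nonempty face $F$ of $P$, the (relatively open) outer normal cone is $\mathcal{N}(F;P)=\{c\in\mathbb{R}^d: S(P;c)=F\}$. A full-dimensional polytope $P\subset\mathbb{R}^d$ is perfectly centered if $\mathrm{relint}(F)\cap\mathcal{N}(F;P)\neq\emptyset$ for every nonempty face $F$ of $P$ (including $F=P$, where $\mathcal{N}(P;P)=\{0\}$, so such a $P$ contains the origin in its interior). The dual is $P^*=\{x:\langle x,y\rangle\le 1\ \forall y\in P\}$, and for a face $F$ of $P$ the associated dual face is $F^D=\{x\in P^*:\langle x,f\rangle=1\ \forall f\in F\}$. *)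

theory Defs
  imports "HOL-Analysis.Analysis" "HOL-Library.Set_Algebras"
begin

definition support_face :: "'a::euclidean_space set \<Rightarrow> 'a \<Rightarrow> 'a set" where
  "support_face P c = {x \<in> P. \<forall>y \<in> P. y \<bullet> c \<le> x \<bullet> c}"

definition normal_cone :: "'a::euclidean_space set \<Rightarrow> 'a set \<Rightarrow> 'a set" where
  "normal_cone F P = {c. support_face P c = F}"

definition perfectly_centered :: "'a::euclidean_space set \<Rightarrow> bool" where
  "perfectly_centered P \<longleftrightarrow>
     (\<forall>F. F face_of P \<and> F \<noteq> {} \<longrightarrow> rel_interior F \<inter> normal_cone F P \<noteq> {})"

definition polar_dual :: "'a::euclidean_space set \<Rightarrow> 'a set" where
  "polar_dual P = {x. \<forall>y \<in> P. x \<bullet> y \<le> 1}"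

definition dual_face :: "'a::euclidean_space set \<Rightarrow> 'a set \<Rightarrow> 'a set" where
  "dual_face P F = {x \<in> polar_dual P. \<forall>f \<in> F. x \<bullet> f = 1}"

definition nontrivial_face_of :: "'a::euclidean_space set \<Rightarrow> 'a set \<Rightarrow> bool"
    (infix \<open>nontrivial'_face'_of\<close> 50) where
  "F nontrivial_face_of P \<longleftrightarrow> F face_of P \<and> F \<noteq> {} \<and> F \<noteq> P"

end

theory Submission
  imports Defs
begin

text \<open>Pick $p_F \<in> \mathrm{relint}(F) \<inter> \mathcal N(F;P)$ for every nonempty face $F$. The key
  fact is that $S(P;c) \<subseteq> F$ whenever $c \<in> F$: extend the segment from $p_F$ to $c$ until it meets
  a proper face of $F$ at $c'$; inductively $S(P;c') \<subseteq> F = S(P;p_F)$, and since $c$ is a convex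
  combination of $c'$ and $p_F$, also $S(P;c) = S(P;c') \<inter> S(P;p_F)$ (if $c \<noteq> p_F, c'$).
  On the other hand $S(P^*;c) = F^D$ for $c$ in the relative interior of a proper face $F$.
  As $S(P+P^*;c) = S(P;c) + S(P^*;c)$, and every nonzero $c$ may be scaled onto the boundary of $P$, every
  nontrivial face of the sum has the required shape. Conversely $G + F^D$ is the face in direction
  $(p_G + p_F)/2$, a point of the relative interior of $F$ that exposes $G = G \<inter> F$ in $P$.\<close>

section \<open>Support faces\<close>

lemma support_face_zero [simp]: "support_face P 0 = P"
  by (auto simp: support_face_def)

lemma support_face_scaleR:
  assumes "r > 0"
  shows "support_face P (r *\<^sub>R c) = support_face P c"
  using assms by (auto simp: support_face_def)

text \<open>A common maximiser \<open>w\<close> attains both maxima at once. With positive weights,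
  a point can match \<open>w\<close> on the combination only if it falls short of \<open>w\<close>
  in neither term.\<close>

lemma support_face_convex_combination:
  assumes "support_face P a \<inter> support_face P b \<noteq> {}" "u > 0" "v > 0"
  shows "support_face P (u *\<^sub>R a + v *\<^sub>R b) = support_face P a \<inter> support_face P b"
proof -
  obtain w where w: "w \<in> P" "\<And>y. y \<in> P \<Longrightarrow> y \<bullet> a \<le> w \<bullet> a" "\<And>y. y \<in> P \<Longrightarrow> y \<bullet> b \<le> w \<bullet> b"
    using assms(1) by (auto simp: support_face_def)
  have "x \<in> support_face P a \<inter> support_face P b" if x: "x \<in> support_face P (u *\<^sub>R a + v *\<^sub>R b)" for x
  proof -
    have xP: "x \<in> P" and "u * (w \<bullet> a) + v * (w \<bullet> b) \<le> u * (x \<bullet> a) + v * (x \<bullet> b)"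
      using x w(1) by (auto simp: support_face_def inner_add_right)
    moreover have "u * (x \<bullet> a) \<le> u * (w \<bullet> a)" "v * (x \<bullet> b) \<le> v * (w \<bullet> b)"
      using w(2,3)[OF xP] assms by auto
    ultimately have "u * (w \<bullet> a) \<le> u * (x \<bullet> a)" "v * (w \<bullet> b) \<le> v * (x \<bullet> b)"
      by linarith+
    then have "w \<bullet> a \<le> x \<bullet> a" "w \<bullet> b \<le> x \<bullet> b"
      using assms by auto
    then show ?thesis
      using xP w(2,3) by (force simp: support_face_def)
  qed
  moreover have "support_face P a \<inter> support_face P b \<subseteq> support_face P (u *\<^sub>R a + v *\<^sub>R b)"
    using assms by (auto simp: support_face_def inner_add_right intro!: add_mono)
  ultimately show ?thesis
    by blast
qed

lemma support_face_plus: "support_face (P + Q) c = support_face P c + support_face Q c"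
proof
  show "support_face (P + Q) c \<subseteq> support_face P c + support_face Q c"
  proof
    fix z
    assume z: "z \<in> support_face (P + Q) c"
    then obtain x y where xy: "z = x + y" "x \<in> P" "y \<in> Q"
      by (auto simp: support_face_def elim: set_plus_elim)
    have max: "(x' + y') \<bullet> c \<le> (x + y) \<bullet> c" if "x' \<in> P" "y' \<in> Q" for x' y'
      using z that xy(1) by (auto simp: support_face_def)
    \<comment> \<open>Freezing one summand in \<open>max\<close> isolates the optimality of the
      other.\<close>
    have "x \<in> support_face P c" "y \<in> support_face Q c"
      using xy max[of _ y] max[of x] by (auto simp: support_face_def inner_add_left)
    then show "z \<in> support_face P c + support_face Q c"
      using xy by auto
  qed
next
  show "support_face P c + support_face Q c \<subseteq> support_face (P + Q) c"
    by (auto simp: support_face_def inner_add_left elim!: set_plus_elim intro!: add_mono)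
qed

lemma support_face_eq_Int_hyperplane:
  assumes "x \<in> support_face P c"
  shows "support_face P c = P \<inter> {y. c \<bullet> y = c \<bullet> x}"
  using assms by (force simp: support_face_def inner_commute)

lemma support_face_face_of:
  assumes "convex P"
  shows "support_face P c face_of P"
proof (cases "support_face P c = {}")
  case False
  then obtain x where x: "x \<in> support_face P c"
    by blast
  show ?thesis
    unfolding support_face_eq_Int_hyperplane[OF x]
    by (rule face_of_Int_supporting_hyperplane_le[OF assms])
       (use x in \<open>auto simp: support_face_def inner_commute\<close>)
qed simp

text \<open>Every face of a polyhedron is exposed. As F is nonempty, the bound \<open>b\<close> is
  attained, so it is the maximum over P and the normal \<open>a\<close> is the direction
  sought.\<close>

lemma face_of_polyhedron_support_face:
  assumes "polyhedron P" "F face_of P" "F \<noteq> {}"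
  obtains c where "F = support_face P c"
proof -
  have "F exposed_face_of P"
    using assms by (simp add: exposed_face_of_polyhedron)
  then obtain a b where ab: "P \<subseteq> {x. a \<bullet> x \<le> b}" "F = P \<inter> {x. a \<bullet> x = b}"
    by (auto simp: exposed_face_of_def)
  have "F = support_face P a"
    using assms(3) ab by (force simp: support_face_def inner_commute)
  then show thesis
    by (rule that)
qed

lemma support_face_eq_self_interior:
  assumes "support_face P c = P" "z \<in> interior P"
  shows "c = 0"
proof -
  obtain e where e: "e > 0" "cball z e \<subseteq> P"
    using assms(2) by (auto simp: mem_interior_cball)
  show "c = 0"
  proof (rule ccontr)
    assume c: "c \<noteq> 0"
    \<comment> \<open>A step of length \<open>e\<close> along c stays in the ball but strictly
      increases the inner product with c.\<close>
    have "z + (e / norm c) *\<^sub>R c \<in> P" "z \<in> P"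
      using e c by (auto simp: subset_iff dist_norm)
    then have "(z + (e / norm c) *\<^sub>R c) \<bullet> c \<le> z \<bullet> c"
      using assms(1) by (auto simp: support_face_def)
    then have "(e / norm c) * (c \<bullet> c) \<le> 0"
      by (simp add: inner_add_left)
    moreover have "(e / norm c) * (c \<bullet> c) > 0"
      using e c by simp
    ultimately show False
      by linarith
  qed
qed

lemma polytope_plus:
  assumes "polytope P" "polytope Q"
  shows "polytope (P + Q)"
  using assms unfolding polytope_def by (metis convex_hull_set_plus finite_set_plus)

section \<open>Polar duality\<close>

lemma polar_dual_contains_0: "0 \<in> polar_dual P"
  by (simp add: polar_dual_def)

lemma bounded_polar_dual:
  assumes "0 \<in> interior P"
  shows "bounded (polar_dual P)"
proof -
  obtain e where e: "e > 0" "cball 0 e \<subseteq> P"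
    using assms by (auto simp: mem_interior_cball)
  have "norm x \<le> 1 / e" if x: "x \<in> polar_dual P" for x
  proof (cases "x = 0")
    case False
    \<comment> \<open>Testing x against the point of norm \<open>e\<close> in its own direction
      bounds its norm by \<open>1 / e\<close>.\<close>
    have "(e / norm x) *\<^sub>R x \<in> P"
      using e False by (auto simp: subset_iff)
    then have "x \<bullet> ((e / norm x) *\<^sub>R x) \<le> 1"
      using x by (auto simp: polar_dual_def)
    then have "e * norm x \<le> 1"
      using False by (simp add: power2_norm_eq_inner[symmetric] power2_eq_square)
    then show ?thesis
      using e by (simp add: field_simps)
  qed (use e in auto)
  then show ?thesis
    by (auto simp: bounded_iff)
qed

lemma polar_dual_convex_hull: "polar_dual (convex hull V) = polar_dual V"
proof
  show "polar_dual (convex hull V) \<subseteq> polar_dual V"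
    using hull_subset[of V convex] by (auto simp: polar_dual_def)
next
  have "convex hull V \<subseteq> {y. x \<bullet> y \<le> 1}" if "x \<in> polar_dual V" for x
    using that by (intro hull_minimal convex_halfspace_le) (auto simp: polar_dual_def)
  then show "polar_dual V \<subseteq> polar_dual (convex hull V)"
    by (force simp: polar_dual_def)
qed

lemma polytope_polar_dual:
  assumes "polytope P" "0 \<in> interior P"
  shows "polytope (polar_dual P)"
proof -
  obtain V where V: "finite V" "P = convex hull V"
    using assms by (auto simp: polytope_def)
  \<comment> \<open>The finitely many generators already impose all constraints, so the polar is a
    polyhedron; boundedness then makes it a polytope.\<close>
  have "polar_dual P = \<Inter> ((\<lambda>v. {x. v \<bullet> x \<le> 1}) ` V)"
    by (auto simp: V polar_dual_convex_hull) (auto simp: polar_dual_def inner_commute)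
  moreover have "polyhedron \<dots>"
    using V by (intro polyhedron_Inter) (auto simp: polyhedron_halfspace_le)
  ultimately show ?thesis
    using bounded_polar_dual[OF assms(2)] by (simp add: polytope_eq_bounded_polyhedron)
qed

text \<open>This is the nontrivial inclusion of the bipolar theorem: a hyperplane separating z from
  P yields a polar point that violates the bound at z.\<close>

lemma mem_if_polar_dual_le_1:
  assumes "convex P" "closed P" "0 \<in> P"
    and z: "\<And>y. y \<in> polar_dual P \<Longrightarrow> y \<bullet> z \<le> 1"
  shows "z \<in> P"
proof (rule ccontr)
  assume "z \<notin> P"
  then obtain a b where ab: "a \<bullet> z < b" "\<And>x. x \<in> P \<Longrightarrow> a \<bullet> x > b"
    using separating_hyperplane_closed_point[OF assms(1,2)] by blast
  have "b < 0"
    using ab(2)[OF assms(3)] by simp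
  \<comment> \<open>Division by the negative \<open>b\<close> reverses both inequalities: the value
    is below 1 on P and above 1 at z.\<close>
  have "(1 / b) *\<^sub>R a \<in> polar_dual P"
    using ab(2) \<open>b < 0\<close> by (force simp: polar_dual_def divide_simps)
  from z[OF this] show False
    using ab(1) \<open>b < 0\<close> by (simp add: divide_simps)
qed

text \<open>Boundedness of P puts a small positive multiple of c into the polar, so the maximum in
  direction c is positive. This is what later allows c to be rescaled to make that maximum
  1.\<close>

lemma polar_dual_support_positive:
  assumes "bounded P" "c \<noteq> 0" "w \<in> support_face (polar_dual P) c"
  shows "w \<bullet> c > 0"
proof -
  obtain B where B: "B > 0" "\<And>y. y \<in> P \<Longrightarrow> norm y \<le> B"
    using assms(1) by (auto simp: bounded_pos)
  have "(1 / (B * norm c)) *\<^sub>R c \<in> polar_dual P"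
    unfolding polar_dual_def
  proof clarify
    fix y
    assume "y \<in> P"
    then have "c \<bullet> y \<le> B * norm c"
      using norm_cauchy_schwarz[of c y] mult_left_mono[OF B(2), of y "norm c"]
      by (simp add: mult.commute)
    then show "(1 / (B * norm c)) *\<^sub>R c \<bullet> y \<le> 1"
      using B(1) assms(2) by simp
  qed
  then have "((1 / (B * norm c)) *\<^sub>R c) \<bullet> c \<le> w \<bullet> c"
    using assms(3) by (auto simp: support_face_def)
  moreover have "((1 / (B * norm c)) *\<^sub>R c) \<bullet> c > 0"
    using B(1) assms(2) by simp
  ultimately show ?thesis
    by linarith
qed

text \<open>As c lies in P, the witness w shows that the maximum over the polar is exactly 1. A
  linear functional bounded by 1 on F that reaches 1 at a relative interior point is constant on
  F.\<close>

lemma support_face_polar_dual: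
  assumes "convex F" "F \<subseteq> P" "c \<in> rel_interior F" "w \<in> polar_dual P" "w \<bullet> c = 1"
  shows "support_face (polar_dual P) c = dual_face P F"
proof
  have cF: "c \<in> F"
    using assms(3) rel_interior_subset by blast
  then show "dual_face P F \<subseteq> support_face (polar_dual P) c"
    using assms(2) by (auto simp: dual_face_def support_face_def polar_dual_def)
  show "support_face (polar_dual P) c \<subseteq> dual_face P F"
  proof
    fix x
    assume x: "x \<in> support_face (polar_dual P) c"
    then have xP: "x \<in> polar_dual P" and "1 \<le> x \<bullet> c"
      using assms(4,5) by (auto simp: support_face_def)
    then have xc: "x \<bullet> c = 1"
      using cF assms(2) by (force simp: polar_dual_def)
    have "x \<bullet> f = 1" if f: "f \<in> F" for f
    proof -
      \<comment> \<open>The segment from f through c extends beyond c inside F; if the value at f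
        were below 1, it would exceed 1 on the extension.\<close>
      obtain e where e: "e > 1" "(1 - e) *\<^sub>R f + e *\<^sub>R c \<in> F"
        using convex_rel_interior_iff[OF assms(1)] assms(3) f by blast
      then have "x \<bullet> ((1 - e) *\<^sub>R f + e *\<^sub>R c) \<le> 1" "x \<bullet> f \<le> 1"
        using xP assms(2) f by (auto simp: polar_dual_def)
      then have "(e - 1) * (1 - x \<bullet> f) \<le> 0" "x \<bullet> f \<le> 1"
        by (auto simp: inner_add_right xc algebra_simps)
      then show ?thesis
        using e(1) by (auto simp: mult_le_0_iff)
    qed
    then show "x \<in> dual_face P F"
      using xP by (simp add: dual_face_def)
  qed
qed

section \<open>Perfectly centered polytopes\<close>

lemma perfectly_centeredE:
  assumes "perfectly_centered P" "F face_of P" "F \<noteq> {}"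
  obtains p where "p \<in> rel_interior F" "p \<in> F" "support_face P p = F"
  using assms rel_interior_subset by (fastforce simp: perfectly_centered_def normal_cone_def)

text \<open>This is the case F = P of the centering condition: a direction that exposes all of a
  full-dimensional P must vanish.\<close>

lemma perfectly_centered_0_interior:
  fixes P :: "'a::euclidean_space set"
  assumes "perfectly_centered P" "convex P" "aff_dim P = int DIM('a)"
  shows "0 \<in> interior P"
proof -
  have "P \<noteq> {}"
    using assms(3) by auto
  then obtain p where p: "p \<in> rel_interior P" "support_face P p = P"
    by (rule perfectly_centeredE[OF assms(1) face_of_refl[OF assms(2)]])
  have "affine hull P = UNIV"
    using assms(3) by (simp only: aff_dim_eq_full)
  then have "p \<in> interior P"
    using p(1) rel_interior_interior by metis
  moreover from this have "p = 0"
    by (rule support_face_eq_self_interior[OF p(2)])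
  ultimately show ?thesis
    by simp
qed

lemma nontrivial_face_not_0:
  assumes "F nontrivial_face_of P" "0 \<in> interior P"
  shows "0 \<notin> F"
proof -
  have "F \<inter> interior P = {}"
    using assms(1) by (intro face_of_disjoint_interior) (simp_all add: nontrivial_face_of_def)
  then show ?thesis
    using assms(2) by blast
qed

lemma support_face_subset_face:
  assumes "polytope P" "perfectly_centered P" "F face_of P" "c \<in> F"
  shows "support_face P c \<subseteq> F \<and> support_face P c \<noteq> {}"
  using assms(3,4)
\<comment> \<open>The empty face has dimension -1, so the shift by 1 keeps \<open>nat\<close> from
  truncating.\<close>
proof (induction "nat (aff_dim F + 1)" arbitrary: F c rule: less_induct)
  case less
  obtain p where p: "p \<in> rel_interior F" "support_face P p = F"
    using perfectly_centeredE[OF assms(2) less.prems(1)] less.prems(2) by blast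
  have F: "polytope F"
    using assms(1) less.prems(1) face_of_polytope_polytope by blast
  show ?case
  proof (cases "c = p")
    case True
    then show ?thesis
      using p less.prems by auto
  next
    case False
    obtain z where z: "z \<in> rel_frontier F" "c \<in> closed_segment p z"
      using segment_to_rel_frontier[OF polytope_imp_convex[OF F] polytope_imp_bounded[OF F] p(1)]
        less.prems(2) False by blast
    obtain F' where F': "F' face_of F" "F' \<noteq> F" "z \<in> F'"
      using z(1) F by (auto simp: rel_frontier_of_polyhedron_alt polytope_imp_polyhedron)
    have "aff_dim F' < aff_dim F" "aff_dim F' \<ge> -1"
      using F' F by (auto intro: face_of_aff_dim_lt polytope_imp_convex aff_dim_geq)
    then have "support_face P z \<subseteq> F'" and ne: "support_face P z \<noteq> {}"
      using less.hyps[of F' z] F' face_of_trans[OF F'(1) less.prems(1)] by auto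
    then have sub: "support_face P z \<subseteq> F"
      using F'(1) face_of_imp_subset by blast
    obtain t where t: "0 \<le> t" "t \<le> 1" "c = (1 - t) *\<^sub>R p + t *\<^sub>R z"
      using z(2) by (auto simp: in_segment)
    have "t \<noteq> 0"
      using t False by auto
    show ?thesis
    \<comment> \<open>For \<open>t = 1\<close> the point c equals z, and the weight of p is 0, which
      the combination lemma excludes.\<close>
    proof (cases "t = 1")
      case True
      then show ?thesis
        using t sub ne by simp
    next
      case False
      \<comment> \<open>The two faces meet because the nonempty face exposed by z lies in F, the
        face exposed by p.\<close>
      have "support_face P c = support_face P p \<inter> support_face P z"
        unfolding t(3)
        by (rule support_face_convex_combination) (use sub ne p t \<open>t \<noteq> 0\<close> False in auto)
      then show ?thesis
        using sub ne p by blast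
    qed
  qed
qed

text \<open>A point outside the relative interior lies on a proper face, and descent in dimension
  ends at the face containing it in its relative interior.\<close>

lemma exists_face_rel_interior:
  fixes P :: "'a::euclidean_space set"
  assumes "polytope P" "c \<in> P"
  shows "\<exists>F. F face_of P \<and> c \<in> rel_interior F"
  using assms
proof (induction "nat (aff_dim P + 1)" arbitrary: P rule: less_induct)
  case less
  show ?case
  proof (cases "c \<in> rel_interior P")
    case True
    then show ?thesis
      using less.prems face_of_refl polytope_imp_convex by blast
  next
    case False
    then have "c \<in> rel_frontier P"
      using less.prems closure_subset by (auto simp: rel_frontier_def)
    then obtain F where F: "F face_of P" "F \<noteq> P" "c \<in> F"
      using less.prems(1) by (auto simp: rel_frontier_of_polyhedron_alt polytope_imp_polyhedron)
    have "aff_dim F < aff_dim P" "aff_dim F \<ge> -1"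
      using F less.prems by (auto intro: face_of_aff_dim_lt polytope_imp_convex aff_dim_geq)
    then have "\<exists>F'. F' face_of F \<and> c \<in> rel_interior F'"
      using less.hyps[of F] F(3) face_of_polytope_polytope[OF less.prems(1) F(1)] by simp
    then show ?thesis
      using face_of_trans[OF _ F(1)] by blast
  qed
qed

text \<open>Serves for P itself and for the Minkowski sum.\<close>

lemma nontrivial_support_face:
  assumes "convex P" "z \<in> interior P" "c \<noteq> 0" "support_face P c \<noteq> {}"
  shows "support_face P c nontrivial_face_of P"
  using assms support_face_face_of support_face_eq_self_interior
  unfolding nontrivial_face_of_def by blast

text \<open>The exposing point p lies in F, so the maximum over P in direction p is
  \<open>p \<bullet> p\<close>, and p divided by this value is a point of the dual face.\<close>

lemma nontrivial_face_polar_point: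
  assumes "perfectly_centered P" "0 \<in> interior P" "F nontrivial_face_of P"
  obtains w where "w \<in> polar_dual P" "\<And>f. f \<in> F \<Longrightarrow> w \<bullet> f = 1"
proof -
  obtain p where p: "p \<in> F" "support_face P p = F"
    using perfectly_centeredE assms(1,3) unfolding nontrivial_face_of_def by metis
  have "p \<bullet> p > 0"
    using p(1) nontrivial_face_not_0[OF assms(3,2)] by auto
  have max: "p \<bullet> y \<le> p \<bullet> p" if "y \<in> P" for y
    using p that by (auto simp: support_face_def inner_commute)
  have eq: "p \<bullet> f = p \<bullet> p" if "f \<in> F" for f
    using p that max[of f] by (force simp: support_face_def inner_commute)
  show thesis
    by (rule that[of "(1 / (p \<bullet> p)) *\<^sub>R p"]) (use \<open>p \<bullet> p > 0\<close> max eq in \<open>auto simp: polar_dual_def\<close>)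
qed

section \<open>Faces of the Minkowski sum\<close>

lemma nontrivial_face_sum_imp:
  assumes P: "polytope P" "perfectly_centered P" and int0: "0 \<in> interior P"
    and H: "H nontrivial_face_of (P + polar_dual P)"
  shows "\<exists>G F. G nontrivial_face_of P \<and> F nontrivial_face_of P \<and> G \<subseteq> F \<and> H = G + dual_face P F"
proof -
  let ?Q = "P + polar_dual P"
  have cvx: "convex P" and "0 \<in> P"
    using P(1) polytope_imp_convex int0 interior_subset by blast+
  have "polyhedron ?Q"
    by (intro polytope_imp_polyhedron polytope_plus polytope_polar_dual P(1) int0)
  then obtain a where a: "H = support_face ?Q a"
    using H face_of_polyhedron_support_face unfolding nontrivial_face_of_def by blast
  have "a \<noteq> 0"
    using H a by (auto simp: nontrivial_face_of_def)
  obtain w where w: "w \<in> support_face (polar_dual P) a"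
    using H by (auto simp: a support_face_plus nontrivial_face_of_def elim: set_plus_elim)
  have wa: "w \<bullet> a > 0"
    using polar_dual_support_positive[OF polytope_imp_bounded[OF P(1)] \<open>a \<noteq> 0\<close> w] .
  \<comment> \<open>This scaling makes the maximum over the polar equal to 1, which places c in P by
    the bipolar argument.\<close>
  define c where "c = (1 / (w \<bullet> a)) *\<^sub>R a"
  have "c \<noteq> 0"
    using \<open>a \<noteq> 0\<close> wa by (simp add: c_def)
  have Hc: "H = support_face P c + support_face (polar_dual P) c"
    using wa by (simp add: a c_def support_face_scaleR support_face_plus)
  have w1: "w \<in> polar_dual P" "w \<bullet> c = 1"
    using w wa by (auto simp: c_def support_face_def)
  have "y \<bullet> c \<le> 1" if "y \<in> polar_dual P" for y
    using that w wa by (auto simp: c_def support_face_def)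
  then have "c \<in> P"
    using mem_if_polar_dual_le_1[OF cvx polytope_imp_closed[OF P(1)] \<open>0 \<in> P\<close>] by blast
  then obtain F where F: "F face_of P" "c \<in> rel_interior F"
    using exists_face_rel_interior[OF P(1)] by metis
  then have cF: "c \<in> F"
    using rel_interior_subset by blast
  have "F \<noteq> P"
  proof
    assume "F = P"
    \<comment> \<open>If c were in the relative interior of P, the segment from 0 could be prolonged
      past c within P, where w takes the value \<open>e > 1\<close>.\<close>
    then obtain e where e: "e > 1" "(1 - e) *\<^sub>R 0 + e *\<^sub>R c \<in> P"
      using convex_rel_interior_iff[OF cvx] \<open>0 \<in> P\<close> F(2) by blast
    then have "w \<bullet> (e *\<^sub>R c) \<le> 1"
      using w1 by (auto simp: polar_dual_def)
    then show False
      using w1 e by simp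
  qed
  then have "F nontrivial_face_of P"
    using F cF by (auto simp: nontrivial_face_of_def)
  moreover have "support_face P c \<subseteq> F" "support_face P c \<noteq> {}"
    using support_face_subset_face[OF P F(1) cF] by auto
  moreover have "support_face P c nontrivial_face_of P"
    using nontrivial_support_face[OF cvx int0 \<open>c \<noteq> 0\<close>] calculation by blast
  moreover have "support_face (polar_dual P) c = dual_face P F"
    using support_face_polar_dual[OF face_of_imp_convex face_of_imp_subset F(2) w1] F(1) by blast
  ultimately show ?thesis
    using Hc by metis
qed

lemma nontrivial_face_sumI:
  assumes P: "polytope P" "perfectly_centered P" and int0: "0 \<in> interior P"
    and G: "G nontrivial_face_of P" and F: "F nontrivial_face_of P" and "G \<subseteq> F"
  shows "(G + dual_face P F) nontrivial_face_of (P + polar_dual P)"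
proof -
  have cvx: "convex P"
    using P(1) polytope_imp_convex by blast
  have cvxF: "convex F" and FP: "F \<subseteq> P"
    using F face_of_imp_convex face_of_imp_subset unfolding nontrivial_face_of_def by blast+
  obtain p where p: "p \<in> F" "p \<in> rel_interior F" "support_face P p = F"
    using perfectly_centeredE[OF P(2)] F unfolding nontrivial_face_of_def by metis
  obtain q where q: "q \<in> G" "support_face P q = G"
    using perfectly_centeredE[OF P(2)] G unfolding nontrivial_face_of_def by metis
  have "G \<noteq> {}"
    using q by blast
  define c where "c = (1/2) *\<^sub>R q + (1/2) *\<^sub>R p"
  have "support_face P c = support_face P q \<inter> support_face P p"
    unfolding c_def
    by (rule support_face_convex_combination) (use p q \<open>G \<subseteq> F\<close> \<open>G \<noteq> {}\<close> in auto)
  then have Gc: "support_face P c = G"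
    using p q \<open>G \<subseteq> F\<close> by blast
  \<comment> \<open>In this form c is the point q of F moved halfway towards the relative interior
    point p, as the shrinking lemma expects.\<close>
  have "c = q - (1/2) *\<^sub>R (q - p)"
    by (simp add: c_def algebra_simps flip: scaleR_add_left)
  then have c: "c \<in> rel_interior F"
    using rel_interior_convex_shrink[OF cvxF p(2), of q "1/2"] q \<open>G \<subseteq> F\<close> by auto
  then have "c \<in> F"
    using rel_interior_subset by blast
  then have "c \<noteq> 0"
    using nontrivial_face_not_0[OF F int0] by blast
  obtain w where w: "w \<in> polar_dual P" "\<And>f. f \<in> F \<Longrightarrow> w \<bullet> f = 1"
    using nontrivial_face_polar_point[OF P(2) int0 F] by blast
  have "support_face (polar_dual P) c = dual_face P F"
    using support_face_polar_dual[OF cvxF FP c w(1)] w(2) \<open>c \<in> F\<close> by blast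
  then have eq: "support_face (P + polar_dual P) c = G + dual_face P F"
    by (simp add: support_face_plus Gc)
  have "w \<in> dual_face P F"
    using w by (simp add: dual_face_def)
  then have ne: "G + dual_face P F \<noteq> {}"
    using \<open>G \<noteq> {}\<close> by blast
  \<comment> \<open>The sum inherits 0 as an interior point from P, so the nonzero direction c
    cannot expose the whole sum.\<close>
  have "P \<subseteq> P + polar_dual P"
    using set_plus_intro[OF _ polar_dual_contains_0[of P]] by fastforce
  then have "0 \<in> interior (P + polar_dual P)"
    using int0 interior_mono by blast
  moreover have "convex (P + polar_dual P)"
    by (intro polytope_imp_convex polytope_plus polytope_polar_dual P(1) int0)
  ultimately show ?thesis
    using nontrivial_support_face \<open>c \<noteq> 0\<close> ne unfolding eq[symmetric] by blast
qed

theorem theorem1: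
  fixes P H :: "'a::euclidean_space set"
  assumes "polytope P"
    and "aff_dim P = int DIM('a)"
    and "perfectly_centered P"
    and "H \<subseteq> P + polar_dual P"
  shows "H nontrivial_face_of (P + polar_dual P) \<longleftrightarrow>
    (\<exists>G F. G nontrivial_face_of P \<and> F nontrivial_face_of P \<and> G \<subseteq> F \<and>
           H = G + dual_face P F)"
proof -
  have int0: "0 \<in> interior P"
    by (rule perfectly_centered_0_interior[OF assms(3) polytope_imp_convex[OF assms(1)] assms(2)])
  show ?thesis
    using nontrivial_face_sum_imp[OF assms(1,3) int0] nontrivial_face_sumI[OF assms(1,3) int0]
    by metis
qed

end
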